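(* Let $f_0\in L^1(\mathbb{R}^2)\cap L^\infty(\mathbb{R}^2)$. Then the solution $\tilde g$ of the self-similar Kolmogorov equation $$\partial_s \tilde{g} = 2(1-e^{-s})\, \partial_{\tilde{v}\tilde{z}} \tilde{g} + \partial_{\tilde{v}}^2 \tilde{g} + (1-e^{-s})^2\, \partial_{\tilde{z}}^2 \tilde{g} + \tfrac{1}{2} \tilde{v}\, \partial_{\tilde{v}} \tilde{g} + \tfrac{3}{2} \tilde{z}\, \partial_{\tilde{z}} \tilde{g}+2\tilde{g},\qquad \tilde g(0,\cdot,\cdot)=f_0,$$ on $\mathbb{R}_+\times\mathbb{R}\times\mathbb{R}$ satisfies, for every $s>0$, $$\|\tilde g(s,\cdot,\cdot)\|_{L^\infty(\mathbb{R}^2)}\leq \min\left\{ \frac{\sqrt{3}}{2\pi}\,\frac{1}{(1-e^{-s})^2}\,\|f_0\|_{L^1(\mathbb{R}^2)},\; e^{2s}\,\|f_0\|_{L^\infty(\mathbb{R}^2)} \right\}.$$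
   Context: The Kolmogorov equation is $\partial_t f-\partial_v^2 f-v\,\partial_x f=0$ with initial datum $f_0$. Setting $f(t,v,x)=g(t,v,x+tv)=g(t,v,z)$, it becomes $\partial_t g=\partial_v^2 g+2t\,\partial_{vz}g+t^2\partial_z^2 g$, $g(0,\cdot,\cdot)=f_0$. Its solution on $\mathbb{R}^2$ is the convolution $g(t,v,z)=(G_t*f_0)(v,z)=\int_{\mathbb{R}^2}G_t(\nu,\zeta)f_0(v-\nu,z-\zeta)\,d\nu\,d\zeta$ with kernel $$G_t(v,z)=\frac{\sqrt{3}}{2\pi t^2}\exp\left(-\frac{1}{4t^3}\left(3z^2+(2tv-3z)^2\right)\right),\qquad t>0.$$ The self-similar change of variables is $\tilde g(s,\tilde v,\tilde z)=e^{2s}\,g(e^s-1,e^{s/2}\tilde v,e^{3s/2}\tilde z)$, which transforms the equation for $g$ into the self-similar equation. The solution $\tilde g$ of the self-similar equation with initial datum $f_0$ is understood as the one given by these formulas, i.e. $\tilde g(s,\tilde v,\tilde z)=e^{2s}(G_{e^s-1}*f_0)(e^{s/2}\tilde v,e^{3s/2}\tilde z)$ for $s>0$. *)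

theory Defs
  imports "HOL-Probability.Essential_Supremum"
begin

text \<open>Norms of functions on the plane, with values in the extended nonnegative reals.\<close>

definition L1_norm :: "(real \<times> real \<Rightarrow> real) \<Rightarrow> ennreal" where
  "L1_norm f = (\<integral>\<^sup>+ x. ennreal \<bar>f x\<bar> \<partial>lebesgue)"

definition Linf_norm :: "(real \<times> real \<Rightarrow> real) \<Rightarrow> ennreal" where
  "Linf_norm f = esssup lebesgue (\<lambda>x. ennreal \<bar>f x\<bar>)"

definition L1_space :: "(real \<times> real \<Rightarrow> real) set" where
  "L1_space = {f \<in> borel_measurable lebesgue. L1_norm f < \<infinity>}"

definition Linf_space :: "(real \<times> real \<Rightarrow> real) set" where
  "Linf_space = {f \<in> borel_measurable lebesgue. Linf_norm f < \<infinity>}"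

definition convolve :: "(real \<times> real \<Rightarrow> real) \<Rightarrow> (real \<times> real \<Rightarrow> real) \<Rightarrow> real \<times> real \<Rightarrow> real" where
  "convolve K f x = (\<integral> y. K y * f (x - y) \<partial>lebesgue)"

definition kolmogorov_kernel :: "real \<Rightarrow> real \<times> real \<Rightarrow> real" where
  "kolmogorov_kernel t = (\<lambda>(v, z).
     sqrt 3 / (2 * pi * t\<^sup>2) * exp (- (1 / (4 * t ^ 3)) * (3 * z\<^sup>2 + (2 * t * v - 3 * z)\<^sup>2)))"

text \<open>
  The solution \<open>g\<close> of \<open>\<partial>\<^sub>t g = \<partial>\<^sub>v\<^sup>2 g + 2 t \<partial>\<^sub>v\<partial>\<^sub>z g + t\<^sup>2 \<partial>\<^sub>z\<^sup>2 g\<close> with initial datum \<open>f0\<close>.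
  It is obtained from the Kolmogorov equation by \<open>f t v x = g t v (x + t v)\<close>.
  The case split is needed because the kernel formula is meaningful only for \<open>t > 0\<close>.
\<close>

definition kolmogorov_solution ::
    "(real \<times> real \<Rightarrow> real) \<Rightarrow> real \<Rightarrow> real \<times> real \<Rightarrow> real" where
  "kolmogorov_solution f0 t =
     (if t = 0 then f0 else convolve (kolmogorov_kernel t) f0)"

text \<open>
  The solution of the self-similar equation
  \<open>\<partial>\<^sub>s g = 2 (1 - e\<^sup>-\<^sup>s) \<partial>\<^sub>v\<partial>\<^sub>z g + \<partial>\<^sub>v\<^sup>2 g + (1 - e\<^sup>-\<^sup>s)\<^sup>2 \<partial>\<^sub>z\<^sup>2 g + (v/2) \<partial>\<^sub>v g + (3z/2) \<partial>\<^sub>z g + 2 g\<close>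
  with initial datum \<open>f0\<close>, understood as the self-similar rescaling of the solution above.
\<close>

definition selfsimilar_solution ::
    "(real \<times> real \<Rightarrow> real) \<Rightarrow> real \<Rightarrow> real \<times> real \<Rightarrow> real" where
  "selfsimilar_solution f0 s = (\<lambda>(v, z).
     exp (2 * s) * kolmogorov_solution f0 (exp s - 1) (exp (s / 2) * v, exp (3 * s / 2) * z))"

end

theory Submission
  imports Defs "HOL-Probability.Distributions"
begin

text \<open>
  For \<open>t > 0\<close> the kernel \<open>G\<^sub>t\<close> is bounded by its value \<open>\<surd>3 / (2 \<pi> t\<^sup>2)\<close> at the origin and is a
  probability density: given \<open>z\<close> it is Gaussian in \<open>v\<close> with mean \<open>3 z / (2 t)\<close> and variance
  \<open>t / 2\<close>, and its marginal in \<open>z\<close> is Gaussian with mean \<open>0\<close> and variance \<open>2 t\<^sup>3 / 3\<close>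
  (\<open>kolmogorov_kernel_eq_normal_densities\<close>). The two endpoint cases of Young's inequality then give
  \<open>\<bar>G\<^sub>t * f\<bar> \<le> \<surd>3 / (2 \<pi> t\<^sup>2) \<parallel>f\<parallel>\<^sub>1\<close> and \<open>\<bar>G\<^sub>t * f\<bar> \<le> \<parallel>f\<parallel>\<^sub>\<infinity>\<close> at every point, and both bounds survive
  the rescaling of the variables. With \<open>t = e\<^sup>s - 1\<close>, the factor \<open>e\<^sup>2\<^sup>s\<close> turns
  \<open>1 / t\<^sup>2\<close> into \<open>1 / (1 - e\<^sup>-\<^sup>s)\<^sup>2\<close>.

  An essential supremum is informative only for a measurable function, so the measurability of the
  solution has to be established too. A Lebesgue measurable datum is replaced by a Borel
  representative, which leaves the convolution unchanged at every point, and Fubini's theorem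
  applies to the representative.
\<close>

section \<open>Reflected translations of Lebesgue measure\<close>

lemma
  fixes x :: "'a::euclidean_space"
  shows distr_lebesgue_reflect: "distr lebesgue lebesgue (\<lambda>y. x - y) = lebesgue"
    and lebesgue_measurable_reflect: "(\<lambda>y. x - y) \<in> lebesgue \<rightarrow>\<^sub>M lebesgue"
proof -
  have T: "(\<lambda>y. x + (\<Sum>j\<in>Basis. ((- 1) * (y \<bullet> j)) *\<^sub>R j)) = (\<lambda>y. x - y)"
    by (simp add: sum_negf euclidean_representation)
  have "lebesgue = density (distr lebesgue lebesgue (\<lambda>y. x - y)) (\<lambda>_. (\<Prod>j\<in>(Basis::'a set). \<bar>-1::real\<bar>))"
    using lebesgue_affine_euclidean[of "\<lambda>_. -1" x] unfolding T by simp
  then show "distr lebesgue lebesgue (\<lambda>y. x - y) = lebesgue"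
    by (simp add: density_1)
  show "(\<lambda>y. x - y) \<in> lebesgue \<rightarrow>\<^sub>M lebesgue"
    using lebesgue_affine_measurable[of "\<lambda>_. -1" x] unfolding T by simp
qed

lemma borel_measurable_lebesgue_reflect:
  fixes x :: "'a::euclidean_space"
  assumes "f \<in> borel_measurable lebesgue"
  shows "(\<lambda>y. f (x - y)) \<in> borel_measurable lebesgue"
  using measurable_compose[OF lebesgue_measurable_reflect assms] .

lemma nn_integral_lebesgue_reflect:
  fixes x :: "'a::euclidean_space"
  assumes "f \<in> borel_measurable lebesgue"
  shows "(\<integral>\<^sup>+y. f (x - y) \<partial>lebesgue) = (\<integral>\<^sup>+y. f y \<partial>lebesgue)"
  using nn_integral_distr[OF lebesgue_measurable_reflect, of f x] assms
  by (simp add: distr_lebesgue_reflect)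

lemma AE_lebesgue_reflect:
  fixes x :: "'a::euclidean_space"
  assumes "AE y in lebesgue. P y"
  shows "AE y in lebesgue. P (x - y)"
proof (rule AE_distrD[OF lebesgue_measurable_reflect])
  show "AE y in distr lebesgue lebesgue (\<lambda>y. x - y). P y"
    unfolding distr_lebesgue_reflect by (rule assms)
qed

section \<open>Endpoint convolution inequalities\<close>

lemma abs_convolve_le_nn_integral:
  "ennreal \<bar>convolve K f x\<bar> \<le> (\<integral>\<^sup>+y. ennreal \<bar>K y\<bar> * ennreal \<bar>f (x - y)\<bar> \<partial>lebesgue)"
proof (cases "integrable lebesgue (\<lambda>y. K y * f (x - y))")
  case True
  then show ?thesis
    using integral_norm_bound_ennreal[OF True]
    by (simp add: convolve_def abs_mult ennreal_mult)
next
  (* The Bochner integral takes the value 0 on a function that is not integrable. *)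
  case False
  then show ?thesis
    by (simp add: convolve_def not_integrable_integral_eq)
qed

lemma abs_convolve_le_sup_L1:
  assumes f: "f \<in> borel_measurable lebesgue" and K: "\<And>y. \<bar>K y\<bar> \<le> c"
  shows "ennreal \<bar>convolve K f x\<bar> \<le> ennreal c * L1_norm f"
proof -
  note [measurable] = f borel_measurable_lebesgue_reflect[OF f, of x]
  have "ennreal \<bar>convolve K f x\<bar> \<le> (\<integral>\<^sup>+y. ennreal c * ennreal \<bar>f (x - y)\<bar> \<partial>lebesgue)"
    by (rule order_trans[OF abs_convolve_le_nn_integral])
      (intro nn_integral_mono mult_right_mono ennreal_leI K, simp)
  also have "\<dots> = ennreal c * (\<integral>\<^sup>+y. ennreal \<bar>f (x - y)\<bar> \<partial>lebesgue)"
    by (rule nn_integral_cmult) measurable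
  also have "\<dots> = ennreal c * L1_norm f"
    unfolding L1_norm_def
    by (subst nn_integral_lebesgue_reflect[where f = "\<lambda>y. ennreal \<bar>f y\<bar>"]) auto
  finally show ?thesis .
qed

lemma abs_convolve_le_L1_Linf:
  assumes K: "K \<in> borel_measurable lebesgue"
  shows "ennreal \<bar>convolve K f x\<bar> \<le> L1_norm K * Linf_norm f"
proof -
  have "AE y in lebesgue. ennreal \<bar>f (x - y)\<bar> \<le> Linf_norm f"
    unfolding Linf_norm_def by (rule AE_lebesgue_reflect) (rule esssup_AE)
  then have "(\<integral>\<^sup>+y. ennreal \<bar>K y\<bar> * ennreal \<bar>f (x - y)\<bar> \<partial>lebesgue)
      \<le> (\<integral>\<^sup>+y. ennreal \<bar>K y\<bar> * Linf_norm f \<partial>lebesgue)"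
    by (intro nn_integral_mono_AE) (auto elim!: eventually_mono intro: mult_left_mono)
  also have "\<dots> = L1_norm K * Linf_norm f"
    unfolding L1_norm_def using K by (intro nn_integral_multc) measurable
  finally show ?thesis
    using abs_convolve_le_nn_integral[of K f x] by (rule order_trans[rotated])
qed

text \<open>
  Reflected translations preserve null sets, so the integrand at each fixed point changes only on a
  null set when \<open>f\<close> is replaced by a Borel representative. The convolution with the
  representative is a parameter integral of a jointly Borel function.
\<close>

lemma borel_measurable_convolve:
  assumes K: "K \<in> borel_measurable borel" and f: "f \<in> borel_measurable lebesgue"
  shows "convolve K f \<in> borel_measurable borel"
proof -
  obtain h where h[measurable]: "h \<in> borel_measurable borel" and ae: "AE x in lborel. f x = h x"
    using completion_ex_borel_measurable_real[OF f] by auto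
  note [measurable] = K
  have K': "K \<in> borel_measurable lebesgue" and h': "h \<in> borel_measurable lebesgue"
    using K h by (auto intro: measurable_completion)
  have "convolve K f x = (\<integral>y. K y * h (x - y) \<partial>lborel)" for x
  proof -
    have "AE y in lebesgue. f (x - y) = h (x - y)"
      using ae by (intro AE_lebesgue_reflect AE_completion)
    then have "convolve K f x = (\<integral>y. K y * h (x - y) \<partial>lebesgue)"
      unfolding convolve_def
      using K' borel_measurable_lebesgue_reflect[OF f, of x]
        borel_measurable_lebesgue_reflect[OF h', of x]
      by (intro integral_cong_AE borel_measurable_times) (auto elim!: eventually_mono)
    then show ?thesis
      by (simp add: integral_completion)
  qed
  moreover have "(\<lambda>x. \<integral>y. K y * h (x - y) \<partial>lborel) \<in> borel_measurable borel"
    by (rule lborel.borel_measurable_lebesgue_integral) measurable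
  ultimately show ?thesis
    by (metis (no_types, lifting) ext)
qed

section \<open>The Kolmogorov kernel as a Gaussian density\<close>

text \<open>
  The exponent is already a sum of squares: \<open>(2 t v - 3 z)\<^sup>2 / (4 t\<^sup>3) = (v - 3 z / (2 t))\<^sup>2 / t\<close>, which
  exhibits the conditional law of \<open>v\<close> given \<open>z\<close>.
\<close>

lemma kolmogorov_kernel_eq_normal_densities:
  assumes t: "t > 0"
  shows "kolmogorov_kernel t (v, z)
    = normal_density (3 * z / (2 * t)) (sqrt (t / 2)) v * normal_density 0 (sqrt (2 * t ^ 3 / 3)) z"
proof -
  have "sqrt (2 * pi * (t / 2)) * sqrt (2 * pi * (2 * t ^ 3 / 3)) = sqrt ((2 * pi * t\<^sup>2)\<^sup>2 / 3)"
    unfolding real_sqrt_mult[symmetric]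
    by (rule arg_cong[where f = sqrt]) (simp add: field_simps power2_eq_square power3_eq_cube)
  also have "\<dots> = 2 * pi * t\<^sup>2 / sqrt 3"
    using t by (simp add: real_sqrt_divide)
  finally have const: "1 / sqrt (2 * pi * (t / 2)) * (1 / sqrt (2 * pi * (2 * t ^ 3 / 3)))
      = sqrt 3 / (2 * pi * t\<^sup>2)"
    by (simp only: times_divide_times_eq mult_1 divide_divide_eq_right)
  have expo: "- (v - 3 * z / (2 * t))\<^sup>2 / (2 * (t / 2)) + - (z - 0)\<^sup>2 / (2 * (2 * t ^ 3 / 3))
      = - (1 / (4 * t ^ 3)) * (3 * z\<^sup>2 + (2 * t * v - 3 * z)\<^sup>2)"
    using t by (simp add: field_simps power2_eq_square power3_eq_cube)
  have sq: "(sqrt (t / 2))\<^sup>2 = t / 2" "(sqrt (2 * t ^ 3 / 3))\<^sup>2 = 2 * t ^ 3 / 3"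
    using t by simp_all
  show ?thesis
    unfolding kolmogorov_kernel_def normal_density_def prod.case sq
    unfolding const[symmetric] expo[symmetric] exp_add by (simp only: mult_ac)
qed

lemma kolmogorov_kernel_nonneg: "0 \<le> kolmogorov_kernel t p"
  by (simp add: kolmogorov_kernel_def split: prod.split)

lemma kolmogorov_kernel_le:
  assumes "t > 0"
  shows "kolmogorov_kernel t p \<le> sqrt 3 / (2 * pi * t\<^sup>2)"
proof -
  obtain v z where p: "p = (v, z)"
    by (cases p)
  have "- (1 / (4 * t ^ 3)) * (3 * z\<^sup>2 + (2 * t * v - 3 * z)\<^sup>2) \<le> 0"
    using assms by (intro mult_nonpos_nonneg) auto
  then have "exp (- (1 / (4 * t ^ 3)) * (3 * z\<^sup>2 + (2 * t * v - 3 * z)\<^sup>2)) \<le> 1"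
    by (simp only: exp_le_one_iff)
  then show ?thesis
    unfolding kolmogorov_kernel_def p prod.case by (rule mult_left_le) simp
qed

lemma borel_measurable_kolmogorov_kernel: "kolmogorov_kernel t \<in> borel_measurable borel"
proof -
  have "kolmogorov_kernel t \<in> borel_measurable (borel \<Otimes>\<^sub>M borel)"
    unfolding kolmogorov_kernel_def by measurable
  then show ?thesis
    by (simp add: borel_prod)
qed

lemma L1_norm_kolmogorov_kernel:
  assumes t: "t > 0"
  shows "L1_norm (kolmogorov_kernel t) = 1"
proof -
  have N: "(\<integral>\<^sup>+v. ennreal (normal_density m \<sigma> v) \<partial>lborel) = 1" if "\<sigma> > 0" for m \<sigma>
    using that by (simp add: nn_integral_eq_integral)
  have meas: "(\<lambda>p. ennreal (kolmogorov_kernel t p)) \<in> borel_measurable (lborel \<Otimes>\<^sub>M lborel)"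
    using borel_measurable_kolmogorov_kernel[of t] by (simp add: lborel_prod)
  have "L1_norm (kolmogorov_kernel t) = (\<integral>\<^sup>+p. ennreal (kolmogorov_kernel t p) \<partial>(lborel \<Otimes>\<^sub>M lborel))"
    by (simp add: L1_norm_def nn_integral_completion kolmogorov_kernel_nonneg lborel_prod)
  also have "\<dots> = (\<integral>\<^sup>+z. \<integral>\<^sup>+v. ennreal (kolmogorov_kernel t (v, z)) \<partial>lborel \<partial>lborel)"
    using lborel_pair.nn_integral_snd[OF meas] by simp
  also have "\<dots> = (\<integral>\<^sup>+z. ennreal (normal_density 0 (sqrt (2 * t ^ 3 / 3)) z) \<partial>lborel)"
    using t by (simp add: kolmogorov_kernel_eq_normal_densities ennreal_mult nn_integral_multc N)
  also have "\<dots> = 1"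
    using t by (intro N) simp
  finally show ?thesis .
qed

section \<open>Decay of the self-similar solution\<close>

theorem proposition3p1:
  fixes f0 :: "real \<times> real \<Rightarrow> real" and s :: real
  assumes "f0 \<in> L1_space \<inter> Linf_space"
    and "s > 0"
  shows "Linf_norm (selfsimilar_solution f0 s)
    \<le> min (ennreal (sqrt 3 / (2 * pi) * (1 / (1 - exp (- s))\<^sup>2)) * L1_norm f0)
          (ennreal (exp (2 * s)) * Linf_norm f0)"
proof -
  define t where "t = exp s - 1"
  have t: "t > 0"
    using \<open>s > 0\<close> by (simp add: t_def)
  have f0: "f0 \<in> borel_measurable lebesgue"
    using assms(1) by (simp add: L1_space_def)
  have sol: "selfsimilar_solution f0 s = (\<lambda>p. exp (2 * s) *
      convolve (kolmogorov_kernel t) f0 (exp (s / 2) * fst p, exp (3 * s / 2) * snd p))"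
    using t by (auto simp: selfsimilar_solution_def kolmogorov_solution_def t_def)
  have meas: "(\<lambda>p. ennreal \<bar>selfsimilar_solution f0 s p\<bar>) \<in> borel_measurable lebesgue"
  proof (rule measurable_completion)
    note [measurable] = borel_measurable_convolve[OF borel_measurable_kolmogorov_kernel f0]
    have [measurable]: "(\<lambda>p::real \<times> real. (exp (s / 2) * fst p, exp (3 * s / 2) * snd p))
        \<in> borel_measurable borel"
      by (intro borel_measurable_continuous_onI continuous_intros)
    show "(\<lambda>p. ennreal \<bar>selfsimilar_solution f0 s p\<bar>) \<in> borel_measurable lborel"
      unfolding sol by measurable
  qed
  have "exp (2 * s) * (sqrt 3 / (2 * pi * t\<^sup>2)) = sqrt 3 / (2 * pi) * (1 / (1 - exp (- s))\<^sup>2)"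
  proof -
    have "t = exp s * (1 - exp (- s))"
      by (simp add: t_def algebra_simps exp_minus)
    then have "t\<^sup>2 = exp (2 * s) * (1 - exp (- s))\<^sup>2"
      by (simp add: power_mult_distrib exp_double)
    then show ?thesis
      by simp
  qed
  then have const: "ennreal (exp (2 * s)) * ennreal (sqrt 3 / (2 * pi * t\<^sup>2))
      = ennreal (sqrt 3 / (2 * pi) * (1 / (1 - exp (- s))\<^sup>2))"
    by (metis ennreal_mult' exp_ge_zero)
  have "ennreal \<bar>convolve (kolmogorov_kernel t) f0 x\<bar> \<le> ennreal (sqrt 3 / (2 * pi * t\<^sup>2)) * L1_norm f0"
    for x
    using kolmogorov_kernel_le[OF t] kolmogorov_kernel_nonneg
    by (intro abs_convolve_le_sup_L1 f0) simp
  then have 1: "ennreal \<bar>selfsimilar_solution f0 s p\<bar>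
      \<le> ennreal (sqrt 3 / (2 * pi) * (1 / (1 - exp (- s))\<^sup>2)) * L1_norm f0" for p
    unfolding sol const[symmetric] by (simp add: abs_mult ennreal_mult mult.assoc mult_left_mono)
  have "ennreal \<bar>convolve (kolmogorov_kernel t) f0 x\<bar> \<le> Linf_norm f0" for x
    using abs_convolve_le_L1_Linf[of "kolmogorov_kernel t" f0 x]
      borel_measurable_kolmogorov_kernel[of t]
    by (simp add: L1_norm_kolmogorov_kernel[OF t] measurable_completion)
  then have 2: "ennreal \<bar>selfsimilar_solution f0 s p\<bar> \<le> ennreal (exp (2 * s)) * Linf_norm f0" for p
    unfolding sol by (simp add: abs_mult ennreal_mult mult_left_mono)
  show ?thesis
    unfolding Linf_norm_def[of "selfsimilar_solution f0 s"]
    using 1 2 by (intro esssup_I meas AE_I2) simp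
qed

end
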